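(* Let $\Lambda,\Lambda'\subset\mathbb{R}^2$ be any lattices. Then $\Lambda,\Lambda'$ are isometric if and only if $\mathrm{RI}(\Lambda)=\mathrm{RI}(\Lambda')$. Moreover, $\Lambda,\Lambda'$ are related by a rigid motion if and only if $\mathrm{RI}^o(\Lambda)=\mathrm{RI}^o(\Lambda')$.
   Context: A lattice $\Lambda\subset\mathbb{R}^2$ is the set of all integer linear combinations of a linear basis of $\mathbb{R}^2$. An isometry is a distance-preserving map of $\mathbb{R}^2$; a rigid motion is an orientation-preserving isometry (a composition of translations and rotations). Lattices are isometric (related by rigid motion) if some isometry (rigid motion) of $\mathbb{R}^2$ maps one onto the other. A superbase of $\Lambda$ is a triple $B=\{v_0,v_1,v_2\}$, where $v_1,v_2$ is a basis generating $\Lambda$ and $v_0=-v_1-v_2$. It is obtuse if all conorms $p_{ij}=-v_i\cdot v_j$ ($i\neq j$) are $\geq 0$. Every lattice in $\mathbb{R}^2$ has an obtuse superbase. The root products are $r_{ij}=\sqrt{p_{ij}}$. The root invariant $\mathrm{RI}(B)$ is the triple of the three root products written in increasing order. A lattice is mirror-symmetric if it is mapped to itself by a reflection in a line. If $B$ generates a mirror-symmetric lattice, put $\mathrm{sign}(B)=0$. Otherwise the vectors of $B$ have three different lengths; let $v_1,v_2$ be the two shortest, with $|v_1|<|v_2|$, and let $\mathrm{sign}(B)=\pm1$ be the sign of the determinant $\det(v_1,v_2)$ of the matrix with columns $v_1,v_2$. The values $\mathrm{RI}(B)$ and $\mathrm{sign}(B)$ do not depend on the choice of an obtuse superbase $B$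 of $\Lambda$ and are denoted $\mathrm{RI}(\Lambda)$, $\mathrm{sign}(\Lambda)$. The oriented root invariant $\mathrm{RI}^o(\Lambda)$ is the pair consisting of $\mathrm{RI}(\Lambda)$ and $\mathrm{sign}(\Lambda)$. *)

theory Defs
  imports "HOL-Analysis.Analysis"
begin

definition linear_basis2 :: "real^2 \<Rightarrow> real^2 \<Rightarrow> bool" where
  "linear_basis2 v1 v2 \<longleftrightarrow> independent {v1, v2} \<and> span {v1, v2} = UNIV"

definition generated_lattice :: "real^2 \<Rightarrow> real^2 \<Rightarrow> (real^2) set" where
  "generated_lattice v1 v2 = {of_int m *\<^sub>R v1 + of_int n *\<^sub>R v2 | m n :: int. True}"

definition planar_lattice :: "(real^2) set \<Rightarrow> bool" where
  "planar_lattice L \<longleftrightarrow> (\<exists>v1 v2. linear_basis2 v1 v2 \<and> L = generated_lattice v1 v2)"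

definition plane_isometry :: "(real^2 \<Rightarrow> real^2) \<Rightarrow> bool" where
  "plane_isometry f \<longleftrightarrow> (\<forall>x y. dist (f x) (f y) = dist x y)"

text \<open>For an isometry \<open>f\<close> the map \<open>x \<mapsto> f x - f 0\<close> is linear, so its matrix and determinant make sense.\<close>
definition orientation_preserving :: "(real^2 \<Rightarrow> real^2) \<Rightarrow> bool" where
  "orientation_preserving f \<longleftrightarrow> det (matrix (\<lambda>x. f x - f 0)) > 0"

definition rigid_motion :: "(real^2 \<Rightarrow> real^2) \<Rightarrow> bool" where
  "rigid_motion f \<longleftrightarrow> plane_isometry f \<and> orientation_preserving f"

lemma rigid_motion_iff_rotation_translation:
  "rigid_motion f \<longleftrightarrow> (\<exists>A c. rotation_matrix A \<and> f = (\<lambda>x. A *v x + c))"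
proof
  assume "rigid_motion f"
  then have iso: "\<And>x y. dist (f x) (f y) = dist x y"
    and dp: "det (matrix (\<lambda>x. f x - f 0)) > 0"
    by (auto simp: rigid_motion_def plane_isometry_def orientation_preserving_def)
  define g where "g = (\<lambda>x. f x - f 0)"
  have ot: "orthogonal_transformation g"
    unfolding orthogonal_transformation_isometry using iso by (simp add: g_def dist_norm)
  then have om: "orthogonal_matrix (matrix g)" and lin: "linear g"
    by (auto simp: orthogonal_transformation_matrix)
  have "rotation_matrix (matrix g)"
    using om det_orthogonal_matrix[OF om] dp by (auto simp: rotation_matrix_def g_def)
  moreover have "f = (\<lambda>x. matrix g *v x + f 0)"
    using lin by (auto simp: g_def fun_eq_iff matrix_works)
  ultimately show "\<exists>A c. rotation_matrix A \<and> f = (\<lambda>x. A *v x + c)" by blast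
next
  assume "\<exists>A c. rotation_matrix A \<and> f = (\<lambda>x. A *v x + c)"
  then obtain A c where A: "rotation_matrix A" and f: "f = (\<lambda>x. A *v x + c)" by blast
  have "orthogonal_transformation ((*v) A)"
    using A by (simp add: rotation_matrix_def orthogonal_transformation_matrix)
  then have "plane_isometry f"
    unfolding plane_isometry_def f orthogonal_transformation_isometry by simp
  moreover have "orientation_preserving f"
    using A by (simp add: orientation_preserving_def f rotation_matrix_def)
  ultimately show "rigid_motion f" by (simp add: rigid_motion_def)
qed

definition lattices_isometric :: "(real^2) set \<Rightarrow> (real^2) set \<Rightarrow> bool" where
  "lattices_isometric L L' \<longleftrightarrow> (\<exists>f. plane_isometry f \<and> f ` L = L')"

definition lattices_rigidly_related :: "(real^2) set \<Rightarrow> (real^2) set \<Rightarrow> bool" where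
  "lattices_rigidly_related L L' \<longleftrightarrow> (\<exists>f. rigid_motion f \<and> f ` L = L')"

text \<open>A superbase is encoded as an ordered triple; being a superbase, and the invariants of an
  obtuse superbase defined below, do not depend on the order of the three vectors.\<close>
type_synonym triple2 = "(real^2) \<times> (real^2) \<times> (real^2)"

fun superbase :: "triple2 \<Rightarrow> (real^2) set \<Rightarrow> bool" where
  "superbase (v0, v1, v2) L \<longleftrightarrow>
     linear_basis2 v1 v2 \<and> L = generated_lattice v1 v2 \<and> v0 = - v1 - v2"

definition conorm :: "real^2 \<Rightarrow> real^2 \<Rightarrow> real" where
  "conorm u v = - (u \<bullet> v)"

fun obtuse :: "triple2 \<Rightarrow> bool" where
  "obtuse (v0, v1, v2) \<longleftrightarrow> conorm v0 v1 \<ge> 0 \<and> conorm v0 v2 \<ge> 0 \<and> conorm v1 v2 \<ge> 0"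

definition obtuse_superbase :: "triple2 \<Rightarrow> (real^2) set \<Rightarrow> bool" where
  "obtuse_superbase B L \<longleftrightarrow> superbase B L \<and> obtuse B"

definition root_product :: "real^2 \<Rightarrow> real^2 \<Rightarrow> real" where
  "root_product u v = sqrt (conorm u v)"

fun superbase_RI :: "triple2 \<Rightarrow> real list" where
  "superbase_RI (v0, v1, v2) = sort [root_product v0 v1, root_product v0 v2, root_product v1 v2]"

text \<open>Reflection in the line through \<open>a\<close> with direction \<open>u \<noteq> 0\<close>: \<open>x - a\<close> is replaced by twice its
  orthogonal projection to the span of \<open>u\<close>, minus \<open>x - a\<close>.\<close>
definition line_reflection :: "real^2 \<Rightarrow> real^2 \<Rightarrow> real^2 \<Rightarrow> real^2" where
  "line_reflection a u x = a + ((2 * ((x - a) \<bullet> u) / (u \<bullet> u)) *\<^sub>R u - (x - a))"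

definition mirror_symmetric :: "(real^2) set \<Rightarrow> bool" where
  "mirror_symmetric L \<longleftrightarrow> (\<exists>a u. u \<noteq> 0 \<and> line_reflection a u ` L = L)"

definition det_columns :: "real^2 \<Rightarrow> real^2 \<Rightarrow> real" where
  "det_columns u v = det (transpose (vector [u, v]) :: real^2^2)"

fun superbase_sign :: "triple2 \<Rightarrow> real" where
  "superbase_sign (v0, v1, v2) =
     (if mirror_symmetric (generated_lattice v1 v2) then 0
      else (let vs = sort_key norm [v0, v1, v2] in sgn (det_columns (vs ! 0) (vs ! 1))))"

text \<open>The invariants of a lattice are those of an arbitrary obtuse superbase; the values are
  independent of the choice.\<close>
definition RI :: "(real^2) set \<Rightarrow> real list" where
  "RI L = superbase_RI (SOME B. obtuse_superbase B L)"

definition lattice_sign :: "(real^2) set \<Rightarrow> real" where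
  "lattice_sign L = superbase_sign (SOME B. obtuse_superbase B L)"

definition oriented_RI :: "(real^2) set \<Rightarrow> real list \<times> real" where
  "oriented_RI L = (RI L, lattice_sign L)"

end

(* A vector of an obtuse superbase is shortest in its class modulo 2L (by Selling's formula), so the
   lengths of the three vectors, and hence the conorms, are determined by the lattice. Conversely,
   equal conorms give equal Gram matrices, hence a linear isometry carrying one superbase to the
   other. If that isometry reverses orientation and the signs agree, then both signs vanish, and
   composing with a mirror symmetry of the lattice gives a rigid motion. An obtuse superbase exists
   because one minimising the sum of squared lengths is obtuse. *)

theory Submission
  imports Defs
begin

section \<open>Bases and determinants\<close>

text \<open>Since \<open>RI\<close> and \<open>lattice_sign\<close> are read off an arbitrarily
  chosen obtuse superbase, the main obstacle is to compare two such superbases of one lattice.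
  Expressing one in the other gives an integer matrix that is invertible modulo 2, so each superbase
  has exactly one vector in each of the three nonzero classes of L/2L. Being shortest in these
  classes, the vectors of two obtuse superbases have the same lengths, class by class. Independence
  of the sign is then a consequence of independence of the root invariant: equal root invariants
  produce an orthogonal map of L to itself that carries one superbase to the other as an unordered
  triple. It either preserves orientation, and so preserves the sign, or is a mirror symmetry, and
  then both signs are 0. This dichotomy rests on a fact special to the plane: an orthogonal map of
  determinant -1 is a reflection in a line.\<close>

lemma det_columns_components: "det_columns u v = u$1 * v$2 - u$2 * v$1"
  by (simp add: det_columns_def det_2 transpose_def)

lemma det_columns_eqs:
  "det_columns (u + u') v = det_columns u v + det_columns u' v"
  "det_columns v (u + u') = det_columns v u + det_columns v u'"
  "det_columns (u - u') v = det_columns u v - det_columns u' v"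
  "det_columns v (u - u') = det_columns v u - det_columns v u'"
  "det_columns (c *\<^sub>R u) v = c * det_columns u v"
  "det_columns v (c *\<^sub>R u) = c * det_columns v u"
  "det_columns (- u) v = - det_columns u v"
  "det_columns v (- u) = - det_columns v u"
  "det_columns u u = 0"
  by (simp_all add: det_columns_components algebra_simps)

lemma det_columns_commute: "det_columns v u = - det_columns u v"
  by (simp add: det_columns_components)

text \<open>A crude form of Hadamard's inequality. The factor 2 is harmless, since the bound only
  serves to show that a ball contains finitely many lattice points.\<close>

lemma abs_det_columns_le: "\<bar>det_columns u v\<bar> \<le> 2 * norm u * norm v"
proof -
  have "\<bar>u$1 * v$2\<bar> \<le> norm u * norm v" "\<bar>u$2 * v$1\<bar> \<le> norm u * norm v"
    by (simp_all add: abs_mult mult_mono component_le_norm_cart)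
  then show ?thesis by (simp add: det_columns_components)
qed

lemma cramer_plane:
  assumes "det_columns v1 v2 \<noteq> 0"
  shows "x = (det_columns x v2 / det_columns v1 v2) *\<^sub>R v1
           + (det_columns v1 x / det_columns v1 v2) *\<^sub>R v2"
proof -
  define d where "d = det_columns v1 v2"
  have "d *\<^sub>R x = det_columns x v2 *\<^sub>R v1 + det_columns v1 x *\<^sub>R v2"
    by (simp add: d_def vec_eq_iff forall_2 det_columns_components algebra_simps)
  then have "x = inverse d *\<^sub>R (det_columns x v2 *\<^sub>R v1 + det_columns v1 x *\<^sub>R v2)"
    using assms d_def by (metis scaleR_scaleR left_inverse scaleR_one)
  then show ?thesis by (simp add: d_def scaleR_add_right divide_inverse mult.commute)
qed

lemma linear_basis2_iff_det: "linear_basis2 v1 v2 \<longleftrightarrow> det_columns v1 v2 \<noteq> 0"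
proof
  assume "linear_basis2 v1 v2"
  then have "\<And>x. x \<in> span {v1, v2}" by (simp add: linear_basis2_def)
  then have ex: "\<exists>a b. x = a *\<^sub>R v1 + b *\<^sub>R v2" for x
    by (simp add: span_breakdown_eq) (metis add.commute diff_add_cancel)
  obtain a b c d where 1: "axis 1 1 = a *\<^sub>R v1 + b *\<^sub>R v2" and 2: "axis 2 1 = c *\<^sub>R v1 + d *\<^sub>R v2"
    using ex by meson
  \<comment> \<open>The determinant is multiplicative under a change of basis, and the standard
    basis has determinant 1, so the second factor cannot vanish.\<close>
  have "det_columns (axis 1 1) (axis 2 1) = (a * d - b * c) * det_columns v1 v2"
    unfolding 1 2 by (simp add: det_columns_components algebra_simps)
  moreover have "det_columns (axis 1 1) (axis 2 1) = 1"
    by (simp add: det_columns_components axis_def)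
  ultimately show "det_columns v1 v2 \<noteq> 0" by auto
next
  assume D: "det_columns v1 v2 \<noteq> 0"
  have "a *\<^sub>R v1 + b *\<^sub>R v2 \<in> span {v1, v2}" for a b
    by (intro span_add span_scale span_base) simp_all
  then have "x \<in> span {v1, v2}" for x using cramer_plane[OF D, of x] by metis
  then have "span {v1, v2} = UNIV" by auto
  moreover have "v1 \<noteq> k *\<^sub>R v2" "v2 \<noteq> 0" for k
    using D by (auto simp: det_columns_components)
  then have "independent {v1, v2}"
    by (auto simp: independent_insert span_singleton)
  ultimately show "linear_basis2 v1 v2" by (simp add: linear_basis2_def)
qed

lemma linear_eq_matrix_plane:
  fixes g :: "real^2 \<Rightarrow> real^2"
  assumes "linear g"
  shows "g x $ i = matrix g $ i $ 1 * x $ 1 + matrix g $ i $ 2 * x $ 2"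
proof -
  have "g x = matrix g *v x" using assms by (simp add: matrix_works)
  then show ?thesis by (simp add: matrix_vector_mult_def sum_2)
qed

lemma det_columns_linear_image:
  assumes "linear g"
  shows "det_columns (g u) (g v) = det (matrix g) * det_columns u v"
  by (simp add: det_columns_components linear_eq_matrix_plane[OF assms] det_2 algebra_simps)

lemma det_orthogonal_transformation:
  fixes g :: "real^2 \<Rightarrow> real^2"
  assumes "orthogonal_transformation g"
  shows "det (matrix g) = 1 \<or> det (matrix g) = -1"
  using assms by (simp add: det_orthogonal_matrix orthogonal_transformation_matrix)

lemma det_matrix_compose:
  fixes f g :: "real^2 \<Rightarrow> real^2"
  assumes "linear f" "linear g"
  shows "det (matrix (g \<circ> f)) = det (matrix g) * det (matrix f)"
  using matrix_compose[OF assms] by (simp add: det_mul)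

text \<open>Equal Gram matrices suffice because the inner product is bilinear: the map keeping the
  coordinates and exchanging the basis preserves every inner product. Cramer's rule supplies the
  coordinates as visibly linear functions.\<close>

lemma orthogonal_transformation_of_basis:
  fixes v1 v2 w1 w2 :: "real^2"
  assumes D: "det_columns v1 v2 \<noteq> 0"
    and "w1 \<bullet> w1 = v1 \<bullet> v1" "w2 \<bullet> w2 = v2 \<bullet> v2" "w1 \<bullet> w2 = v1 \<bullet> v2"
  obtains g where "orthogonal_transformation g" "g v1 = w1" "g v2 = w2"
proof
  define a where "a x = det_columns x v2 / det_columns v1 v2" for x
  define b where "b x = det_columns v1 x / det_columns v1 v2" for x
  define g where "g x = a x *\<^sub>R w1 + b x *\<^sub>R w2" for x
  have x: "x = a x *\<^sub>R v1 + b x *\<^sub>R v2" for x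
    unfolding a_def b_def by (rule cramer_plane[OF D])
  have "linear g"
    by (rule linearI)
      (simp_all add: g_def a_def b_def det_columns_eqs add_divide_distrib algebra_simps)
  moreover have "g x \<bullet> g y = x \<bullet> y" for x y
  proof -
    have "w2 \<bullet> w1 = v2 \<bullet> v1" using assms(4) by (simp add: inner_commute)
    then have "g x \<bullet> g y = (a x *\<^sub>R v1 + b x *\<^sub>R v2) \<bullet> (a y *\<^sub>R v1 + b y *\<^sub>R v2)"
      by (simp add: g_def inner_add_left inner_add_right assms(2-4))
    also have "\<dots> = x \<bullet> y" by (simp only: x[symmetric])
    finally show ?thesis .
  qed
  ultimately show "orthogonal_transformation g" by (simp add: orthogonal_transformation_def)
  show "g v1 = w1" "g v2 = w2"
    using D by (simp_all add: g_def a_def b_def det_columns_eqs)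
qed

section \<open>Lattices and isometries\<close>

lemma generated_lattice_linear_image:
  assumes "linear g"
  shows "g ` generated_lattice v1 v2 = generated_lattice (g v1) (g v2)"
proof -
  have "g ` generated_lattice v1 v2 =
      {g (of_int m *\<^sub>R v1 + of_int n *\<^sub>R v2) | m n :: int. True}"
    unfolding generated_lattice_def by blast
  then show ?thesis
    by (simp add: generated_lattice_def linear_add[OF assms] linear_cmul[OF assms])
qed

lemma generated_latticeI: "of_int m *\<^sub>R v1 + of_int n *\<^sub>R v2 \<in> generated_lattice v1 v2"
  by (auto simp: generated_lattice_def)

lemma generated_latticeE:
  assumes "x \<in> generated_lattice v1 v2"
  obtains m n :: int where "x = of_int m *\<^sub>R v1 + of_int n *\<^sub>R v2"
  using assms by (auto simp: generated_lattice_def)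

lemma generated_lattice_diff:
  assumes "x \<in> generated_lattice v1 v2" "y \<in> generated_lattice v1 v2"
  shows "x - y \<in> generated_lattice v1 v2"
proof -
  obtain m n m' n' :: int where "x = of_int m *\<^sub>R v1 + of_int n *\<^sub>R v2"
    "y = of_int m' *\<^sub>R v1 + of_int n' *\<^sub>R v2"
    using assms by (metis generated_latticeE)
  then have "x - y = of_int (m - m') *\<^sub>R v1 + of_int (n - n') *\<^sub>R v2"
    by (simp add: algebra_simps)
  then show ?thesis using generated_latticeI by metis
qed

lemma generated_lattice_mem:
  "v1 \<in> generated_lattice v1 v2" "v2 \<in> generated_lattice v1 v2" "0 \<in> generated_lattice v1 v2"
  using generated_latticeI[of 1 v1 0 v2] generated_latticeI[of 0 v1 1 v2] generated_latticeI[of 0 v1 0 v2]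
  by simp_all

lemma planar_lattice_zero: "planar_lattice L \<Longrightarrow> 0 \<in> L"
  by (auto simp: planar_lattice_def generated_lattice_mem)

lemma planar_lattice_diff: "planar_lattice L \<Longrightarrow> x \<in> L \<Longrightarrow> y \<in> L \<Longrightarrow> x - y \<in> L"
  by (auto simp: planar_lattice_def generated_lattice_diff)

lemma planar_lattice_add: "planar_lattice L \<Longrightarrow> x \<in> L \<Longrightarrow> y \<in> L \<Longrightarrow> x + y \<in> L"
  using planar_lattice_diff[of L x "0 - y"] planar_lattice_diff[of L 0 y] planar_lattice_zero[of L]
  by simp

lemma generated_lattice_subset:
  assumes "w1 \<in> generated_lattice v1 v2" "w2 \<in> generated_lattice v1 v2"
  shows "generated_lattice w1 w2 \<subseteq> generated_lattice v1 v2"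
proof
  fix x assume "x \<in> generated_lattice w1 w2"
  then obtain m n where x: "x = of_int m *\<^sub>R w1 + of_int n *\<^sub>R w2" by (rule generated_latticeE)
  obtain a b c d :: int where "w1 = of_int a *\<^sub>R v1 + of_int b *\<^sub>R v2"
    "w2 = of_int c *\<^sub>R v1 + of_int d *\<^sub>R v2"
    using assms by (metis generated_latticeE)
  then have "x = of_int (m * a + n * c) *\<^sub>R v1 + of_int (m * b + n * d) *\<^sub>R v2"
    by (simp add: x algebra_simps)
  then show "x \<in> generated_lattice v1 v2" using generated_latticeI by metis
qed

section \<open>Reduction of isometries between lattices to orthogonal linear maps\<close>

lemma linear_part_image:
  assumes "f ` L = L'" "planar_lattice L" "planar_lattice L'"
  shows "(\<lambda>x. f x - f 0) ` L = L'"
proof -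
  \<comment> \<open>As 0 lies in \<open>L\<close>, its image is a vector of \<open>L'\<close>, and
    translating by it maps \<open>L'\<close> onto itself.\<close>
  have f0: "f 0 \<in> L'" using assms planar_lattice_zero by blast
  show ?thesis
  proof
    show "(\<lambda>x. f x - f 0) ` L \<subseteq> L'" using assms f0 planar_lattice_diff by blast
    show "L' \<subseteq> (\<lambda>x. f x - f 0) ` L"
    proof
      fix y assume "y \<in> L'"
      then have "y + f 0 \<in> f ` L" using assms f0 planar_lattice_add by blast
      then obtain x where "x \<in> L" "y = f x - f 0" by (metis add_diff_cancel imageE)
      then show "y \<in> (\<lambda>x. f x - f 0) ` L" by blast
    qed
  qed
qed

lemma orthogonal_linear_part:
  assumes "plane_isometry f"
  shows "orthogonal_transformation (\<lambda>x. f x - f 0)"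
  unfolding orthogonal_transformation_isometry using assms by (simp add: plane_isometry_def dist_norm)

lemma orthogonal_plane_isometry:
  assumes "orthogonal_transformation f"
  shows "plane_isometry f"
  using assms by (simp add: plane_isometry_def orthogonal_transformation_isometry)

lemma lattices_isometric_iff:
  assumes "planar_lattice L" "planar_lattice L'"
  shows "lattices_isometric L L' \<longleftrightarrow> (\<exists>g. orthogonal_transformation g \<and> g ` L = L')"
  unfolding lattices_isometric_def
  using assms linear_part_image orthogonal_linear_part orthogonal_plane_isometry by meson

lemma lattices_rigidly_related_iff:
  assumes "planar_lattice L" "planar_lattice L'"
  shows "lattices_rigidly_related L L' \<longleftrightarrow>
    (\<exists>g. orthogonal_transformation g \<and> det (matrix g) = 1 \<and> g ` L = L')"
proof
  assume "lattices_rigidly_related L L'"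
  then obtain f where f: "plane_isometry f" "orientation_preserving f" "f ` L = L'"
    by (auto simp: lattices_rigidly_related_def rigid_motion_def)
  have o: "orthogonal_transformation (\<lambda>x. f x - f 0)" by (rule orthogonal_linear_part[OF f(1)])
  have "det (matrix (\<lambda>x. f x - f 0)) = 1"
    using det_orthogonal_transformation[OF o] f(2) by (auto simp: orientation_preserving_def)
  then show "\<exists>g. orthogonal_transformation g \<and> det (matrix g) = 1 \<and> g ` L = L'"
    using o linear_part_image[OF f(3) assms] by blast
next
  assume "\<exists>g. orthogonal_transformation g \<and> det (matrix g) = 1 \<and> g ` L = L'"
  then obtain g where g: "orthogonal_transformation g" "det (matrix g) = 1" "g ` L = L'" by blast
  have "g 0 = 0" using g(1) by (simp add: orthogonal_transformation_linear linear_0)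
  then have "rigid_motion g"
    using g by (simp add: rigid_motion_def orthogonal_plane_isometry orientation_preserving_def)
  then show "lattices_rigidly_related L L'" using g by (auto simp: lattices_rigidly_related_def)
qed

section \<open>Mirror symmetry\<close>

lemma orthogonal_line_reflection:
  assumes "u \<noteq> 0"
  shows "orthogonal_transformation (line_reflection 0 u)"
proof -
  have u: "u \<bullet> u \<noteq> 0" using assms by simp
  have "linear (line_reflection 0 u)"
    by (rule linearI)
      (simp_all add: line_reflection_def inner_add_left add_divide_distrib algebra_simps)
  moreover have "line_reflection 0 u x \<bullet> line_reflection 0 u y = x \<bullet> y" for x y
    using u by (simp add: line_reflection_def inner_diff_left inner_diff_right inner_commute field_simps)
  ultimately show ?thesis by (simp add: orthogonal_transformation_def)
qed

lemma det_line_reflection: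
  assumes "u \<noteq> 0"
  shows "det (matrix (line_reflection 0 u)) = -1"
proof -
  \<comment> \<open>\<open>w\<close> is \<open>u\<close> turned by a right angle. The reflection
    fixes \<open>u\<close> and negates \<open>w\<close>, so it negates their determinant, which is
    the nonzero number \<open>u \<bullet> u\<close>.\<close>
  define w :: "real^2" where "w = vector [- u$2, u$1]"
  have u: "u \<bullet> u \<noteq> 0" using assms by simp
  have lin: "linear (line_reflection 0 u)"
    using orthogonal_line_reflection[OF assms] by (rule orthogonal_transformation_linear)
  have "w \<bullet> u = 0" by (simp add: w_def inner_vec_def sum_2)
  then have "line_reflection 0 u u = u" "line_reflection 0 u w = - w"
    using u by (simp_all add: line_reflection_def scaleR_2)
  then have "det (matrix (line_reflection 0 u)) * det_columns u w = - det_columns u w"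
    using det_columns_linear_image[OF lin, of u w] by (simp add: det_columns_eqs)
  moreover have "det_columns u w = u \<bullet> u"
    by (simp add: w_def det_columns_components inner_vec_def sum_2)
  ultimately have "(det (matrix (line_reflection 0 u)) + 1) * (u \<bullet> u) = 0"
    by (simp add: distrib_right)
  then show ?thesis using u by simp
qed

lemma orthogonal_det_neg_is_reflection:
  fixes g :: "real^2 \<Rightarrow> real^2"
  assumes g: "orthogonal_transformation g" and d: "det (matrix g) = -1"
  obtains u where "u \<noteq> 0" "g = line_reflection 0 u"
proof -
  have lin: "linear g" using g by (rule orthogonal_transformation_linear)
  define a b c e where "a = matrix g $ 1 $ 1" and "b = matrix g $ 1 $ 2"
    and "c = matrix g $ 2 $ 1" and "e = matrix g $ 2 $ 2"
  note abce = this
  have "transpose (matrix g) ** matrix g = mat 1"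
    using g by (simp add: orthogonal_transformation_matrix orthogonal_matrix)
  then have "a * a + c * c = 1" "b * b + e * e = 1"
    by (simp_all add: vec_eq_iff forall_2 matrix_matrix_mult_def transpose_def mat_def sum_2 abce)
  moreover have "a * e - b * c = -1" using d by (simp add: det_2 abce)
  \<comment> \<open>Expanding gives the four squares, with sum 2, plus
    \<open>2 * (a * e - b * c)\<close>, which is -2. Hence the matrix is symmetric with trace
    0.\<close>
  ultimately have "(a + e)^2 + (b - c)^2 = 0" by (simp add: power2_eq_square algebra_simps)
  then have e: "e = - a" "c = b" by (auto simp: sum_power2_eq_zero_iff)
  have ab: "b * b = 1 - a * a" using \<open>a * a + c * c = 1\<close> e by simp
  have gx: "g x $ 1 = a * x $ 1 + b * x $ 2" "g x $ 2 = b * x $ 1 - a * x $ 2" for x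
    by (simp_all add: linear_eq_matrix_plane[OF lin] e flip: abce)
  show ?thesis
  proof (cases "a = -1")
    \<comment> \<open>Here the axis vector chosen in the other case would be 0; the map only negates
      the first coordinate.\<close>
    case True
    then have "b = 0" using ab by simp
    then have "g = line_reflection 0 (vector [0, 1])"
      using True by (simp add: fun_eq_iff vec_eq_iff forall_2 gx line_reflection_def inner_vec_def sum_2)
    moreover have "vector [0, 1] \<noteq> (0 :: real^2)" by (simp add: vec_eq_iff forall_2)
    ultimately show ?thesis using that by blast
  next
    case False
    \<comment> \<open>This is \<open>e + g e\<close> for the first standard basis vector
      \<open>e\<close>. It is fixed by \<open>g\<close>, because \<open>g\<close> is an involution,
      and so it spans the axis.\<close>
    define u :: "real^2" where "u = vector [1 + a, b]"
    have u: "u \<bullet> u = 2 * (1 + a)"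
      by (simp add: u_def inner_vec_def sum_2 ab algebra_simps)
    have q: "2 * (x \<bullet> u) / (u \<bullet> u) = x$1 + b * x$2 / (1 + a)" for x
      using False unfolding u by (simp add: u_def inner_vec_def sum_2 field_simps)
    have b: "b * (b * y) / (1 + a) = (1 - a) * y" for y
    proof -
      have "b * (b * y) = (1 - a * a) * y" by (simp flip: ab)
      also have "\<dots> = ((1 - a) * y) * (1 + a)" by (simp add: algebra_simps)
      finally show ?thesis
        using False by (simp only: nonzero_mult_div_cancel_right[of "1 + a"])
    qed
    have "g x = line_reflection 0 u x" for x
    proof -
      have "(x$1 + b * x$2 / (1 + a)) * (1 + a) - x$1 = a * x$1 + b * x$2"
        using False by (simp add: field_simps)
      moreover have "(x$1 + b * x$2 / (1 + a)) * b - x$2 = b * x$1 - a * x$2"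
        using b[of "x$2"] by (simp add: algebra_simps)
      ultimately show ?thesis
        unfolding line_reflection_def diff_zero q
        by (simp add: vec_eq_iff forall_2 gx u_def)
    qed
    moreover have "u \<noteq> 0" using False by (auto simp: u_def vec_eq_iff forall_2)
    ultimately show ?thesis using that by blast
  qed
qed

text \<open>A mirror need not pass through the origin, but the linear part of the reflection is the
  reflection in the parallel line through 0, and it also preserves the lattice. Conversely, every
  orthogonal map of determinant -1 is such a reflection.\<close>

lemma mirror_symmetric_iff:
  assumes "planar_lattice L"
  shows "mirror_symmetric L \<longleftrightarrow>
    (\<exists>s. orthogonal_transformation s \<and> det (matrix s) = -1 \<and> s ` L = L)"
proof
  assume "mirror_symmetric L"
  then obtain a u where u: "u \<noteq> 0" and L: "line_reflection a u ` L = L"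
    by (auto simp: mirror_symmetric_def)
  have "(\<lambda>x. line_reflection a u x - line_reflection a u 0) = line_reflection 0 u"
    by (simp add: fun_eq_iff line_reflection_def inner_diff_left diff_divide_distrib algebra_simps)
  then have "line_reflection 0 u ` L = L" using linear_part_image[OF L assms assms] by (simp only:)
  then show "\<exists>s. orthogonal_transformation s \<and> det (matrix s) = -1 \<and> s ` L = L"
    using orthogonal_line_reflection[OF u] det_line_reflection[OF u] by blast
next
  assume "\<exists>s. orthogonal_transformation s \<and> det (matrix s) = -1 \<and> s ` L = L"
  then show "mirror_symmetric L"
    unfolding mirror_symmetric_def using orthogonal_det_neg_is_reflection by metis
qed

text \<open>Conjugating a reflection by an orthogonal map gives the reflection in the image of its
  line. The converse is the same argument for the inverse map.\<close>

lemma mirror_symmetric_orthogonal_image: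
  assumes g: "orthogonal_transformation g"
  shows "mirror_symmetric (g ` L) \<longleftrightarrow> mirror_symmetric L"
proof -
  have imp: "mirror_symmetric (h ` M)"
    if h: "orthogonal_transformation h" and mirror: "mirror_symmetric M" for h M
  proof -
    obtain a u where u: "u \<noteq> 0" and M: "line_reflection a u ` M = M"
      using mirror by (auto simp: mirror_symmetric_def)
    have lin: "linear h" using h by (rule orthogonal_transformation_linear)
    have in_eq: "h x \<bullet> h y = x \<bullet> y" for x y using h by (simp add: orthogonal_transformation_def)
    have "line_reflection (h a) (h u) (h x) = h (line_reflection a u x)" for x
    proof -
      have "(h x - h a) \<bullet> h u = (x - a) \<bullet> u"
        using in_eq[of "x - a" u] by (simp only: linear_diff[OF lin])
      then show ?thesis
        by (simp only: line_reflection_def in_eq linear_diff[OF lin] linear_add[OF lin] linear_cmul[OF lin])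
    qed
    then have "line_reflection (h a) (h u) ` h ` M = h ` M"
      by (subst (2) M[symmetric]) (simp only: image_image)
    moreover have "h u \<noteq> 0" using in_eq[of u u] u by auto
    ultimately show ?thesis by (auto simp: mirror_symmetric_def)
  qed
  have "inv g ` g ` L = L"
    using orthogonal_transformation_inj[OF g] by (simp add: image_inv_f_f)
  then show ?thesis
    using imp[OF g, of L] imp[OF orthogonal_transformation_inv[OF g], of "g ` L"] by auto
qed

section \<open>Superbases\<close>

declare superbase.simps [simp del]

lemma mset_pair_cases:
  assumes "mset [b, c] = mset [y, z]"
  shows "b = y \<and> c = z \<or> b = z \<and> c = y"
  using assms by (auto simp: add_eq_conv_ex)

text \<open>Superbases are unordered but encoded as ordered triples, so equality up to order is
  expressed by multisets, which also handle repeated entries. This lemma turns it into the six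
  permutations.\<close>

lemma mset_triple_cases:
  assumes "mset [a, b, c] = mset [x, y, z]"
  obtains "a = x" "b = y" "c = z" | "a = x" "b = z" "c = y" | "a = y" "b = x" "c = z"
    | "a = y" "b = z" "c = x" | "a = z" "b = x" "c = y" | "a = z" "b = y" "c = x"
proof -
  have "a \<in> set [x, y, z]" using mset_eq_setD[OF assms] by auto
  then consider "a = x" | "a = y" | "a = z" by auto
  then show ?thesis
  proof cases
    case 1
    then have "mset [b, c] = mset [y, z]" using assms by simp
    then show ?thesis using that 1 by (blast dest: mset_pair_cases)
  next
    case 2
    then have "mset [b, c] = mset [x, z]" using assms by (simp add: add_mset_commute)
    then show ?thesis using that 2 by (blast dest: mset_pair_cases)
  next
    case 3
    then have "mset [b, c] = mset [x, y]" using assms by (simp add: add_mset_commute)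
    then show ?thesis using that 3 by (blast dest: mset_pair_cases)
  qed
qed

lemma superbase_iff:
  "superbase (v0, v1, v2) L \<longleftrightarrow>
    det_columns v1 v2 \<noteq> 0 \<and> L = generated_lattice v1 v2 \<and> v0 = - v1 - v2"
  by (simp add: superbase.simps linear_basis2_iff_det)

lemma superbaseI:
  assumes "superbase (v0, v1, v2) L" "det_columns w1 w2 \<noteq> 0" "w0 = - w1 - w2"
    and "w1 \<in> L" "w2 \<in> L" "v1 \<in> generated_lattice w1 w2" "v2 \<in> generated_lattice w1 w2"
  shows "superbase (w0, w1, w2) L"
  using assms generated_lattice_subset[of w1 v1 v2 w2] generated_lattice_subset[of v1 w1 w2 v2]
  unfolding superbase_iff by blast

lemma superbase_swap:
  assumes "superbase (v0, v1, v2) L"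
  shows "superbase (v1, v0, v2) L" "superbase (v0, v2, v1) L"
proof -
  have v0: "v0 = - v1 - v2" and D: "det_columns v1 v2 \<noteq> 0" and L: "L = generated_lattice v1 v2"
    using assms by (simp_all add: superbase_iff)
  show "superbase (v0, v2, v1) L"
    using D generated_latticeI[of 0 v2 1 v1]
    by (intro superbaseI[OF assms]) (simp_all add: v0 L det_columns_commute[of v2 v1] generated_lattice_mem)
  show "superbase (v1, v0, v2) L"
    using D generated_latticeI[of "-1" v1 "-1" v2] generated_latticeI[of "-1" v0 "-1" v2]
    by (intro superbaseI[OF assms]) (simp_all add: v0 L det_columns_eqs generated_lattice_mem)
qed

lemma superbase_permute:
  assumes "superbase (v0, v1, v2) L" "mset [u0, u1, u2] = mset [v0, v1, v2]"
  shows "superbase (u0, u1, u2) L"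
  using assms(2) by (rule mset_triple_cases) (metis superbase_swap assms(1))+

lemma sort_eq_iff_mset_eq: "sort xs = sort ys \<longleftrightarrow> mset xs = mset ys"
  by (metis mset_sort sorted_list_of_multiset_mset)

lemma root_product_commute: "root_product u v = root_product v u"
  by (simp add: root_product_def conorm_def inner_commute)

lemma superbase_RI_permute:
  assumes "mset [u0, u1, u2] = mset [v0, v1, v2]"
  shows "superbase_RI (u0, u1, u2) = superbase_RI (v0, v1, v2)"
  using assms
  by (rule mset_triple_cases)
    (simp_all add: sort_eq_iff_mset_eq root_product_commute[of v1 v0] root_product_commute[of v2 v0]
      root_product_commute[of v2 v1] del: sort_key_simps)

section \<open>Existence of obtuse superbases\<close>

text \<open>Selling's reduction step. It replaces \<open>v0 = - v1 - v2\<close> by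
  \<open>v1 - v2\<close> and so changes the sum of the squared lengths by
  \<open>4 * conorm v1 v2\<close>; a negative conorm would therefore contradict minimality.\<close>

lemma superbase_reduce:
  assumes "superbase (v0, v1, v2) L"
  shows "superbase (v1 - v2, - v1, v2) L"
  using assms generated_latticeI[of "-1" v1 0 v2] generated_latticeI[of "-1" "- v1" 0 v2]
  by (intro superbaseI[OF assms]) (simp_all add: superbase_iff det_columns_eqs generated_lattice_mem)

lemma finite_lattice_ball:
  assumes D: "det_columns v1 v2 \<noteq> 0"
  shows "finite {x \<in> generated_lattice v1 v2. norm x \<le> R}"
proof -
  \<comment> \<open>By Cramer's rule the coordinates of \<open>x\<close> are quotients of
    determinants, which \<open>abs_det_columns_le\<close> bounds. The sum of the two norms gives one
    bound for both coordinates.\<close>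
  define K where "K = 2 * R * (norm v1 + norm v2) / \<bar>det_columns v1 v2\<bar>"
  define k where "k = \<lceil>K\<rceil>"
  have "{x \<in> generated_lattice v1 v2. norm x \<le> R}
      \<subseteq> (\<lambda>(m, n). of_int m *\<^sub>R v1 + of_int n *\<^sub>R v2) ` ({-k..k} \<times> {-k..k})"
  proof
    fix x assume "x \<in> {x \<in> generated_lattice v1 v2. norm x \<le> R}"
    then have xR: "norm x \<le> R" and "x \<in> generated_lattice v1 v2" by auto
    then obtain m n where x: "x = of_int m *\<^sub>R v1 + of_int n *\<^sub>R v2" by (metis generated_latticeE)
    have R: "0 \<le> R" using xR norm_ge_zero order_trans by blast
    have "det_columns x v2 = of_int m * det_columns v1 v2"
      "det_columns v1 x = of_int n * det_columns v1 v2"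
      by (simp_all add: x det_columns_eqs)
    then have "\<bar>of_int m\<bar> * \<bar>det_columns v1 v2\<bar> \<le> 2 * norm x * norm v2"
      "\<bar>of_int n\<bar> * \<bar>det_columns v1 v2\<bar> \<le> 2 * norm v1 * norm x"
      using abs_det_columns_le[of x v2] abs_det_columns_le[of v1 x] by (simp_all add: abs_mult)
    moreover have "norm x * norm v2 \<le> R * (norm v1 + norm v2)" "norm v1 * norm x \<le> R * (norm v1 + norm v2)"
      using mult_mono[of "norm x" R "norm v2" "norm v1 + norm v2"]
        mult_mono[of "norm x" R "norm v1" "norm v1 + norm v2"] xR R
      by (simp_all add: mult.commute)
    ultimately have "\<bar>of_int m\<bar> * \<bar>det_columns v1 v2\<bar> \<le> 2 * R * (norm v1 + norm v2)"
      "\<bar>of_int n\<bar> * \<bar>det_columns v1 v2\<bar> \<le> 2 * R * (norm v1 + norm v2)"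
      by linarith+
    then have "\<bar>of_int m\<bar> \<le> K" "\<bar>of_int n\<bar> \<le> K"
      using D by (simp_all add: K_def pos_le_divide_eq)
    then have "\<bar>m\<bar> \<le> k" "\<bar>n\<bar> \<le> k" unfolding k_def by linarith+
    then show "x \<in> (\<lambda>(m, n). of_int m *\<^sub>R v1 + of_int n *\<^sub>R v2) ` ({-k..k} \<times> {-k..k})"
      by (intro image_eqI[of _ _ "(m, n)"]) (auto simp: x)
  qed
  then show ?thesis by (rule finite_subset) simp
qed

definition superbase_energy :: "triple2 \<Rightarrow> real" where
  "superbase_energy = (\<lambda>(v0, v1, v2). v0 \<bullet> v0 + v1 \<bullet> v1 + v2 \<bullet> v2)"

lemma superbase_subset:
  assumes "superbase (v0, v1, v2) L"
  shows "{v0, v1, v2} \<subseteq> L"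
  using assms superbase_swap(1)[OF assms] by (auto simp: superbase_iff generated_lattice_mem)

lemma ex_min_energy_superbase:
  assumes "planar_lattice L"
  obtains B where "superbase B L" "\<And>B'. superbase B' L \<Longrightarrow> superbase_energy B \<le> superbase_energy B'"
proof -
  obtain v1 v2 where D: "det_columns v1 v2 \<noteq> 0" and L: "L = generated_lattice v1 v2"
    using assms by (auto simp: planar_lattice_def linear_basis2_iff_det)
  define E where "E = superbase_energy (- v1 - v2, v1, v2)"
  \<comment> \<open>Infinitely many superbases compete, but only those with energy at most that of a
    fixed one matter. Their vectors have length at most \<open>sqrt E\<close>, so they are finite in
    number.\<close>
  define S where "S = {B. superbase B L \<and> superbase_energy B \<le> E}"
  define A where "A = {x \<in> L. norm x \<le> sqrt E}"
  have "S \<subseteq> A \<times> A \<times> A"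
  proof
    fix B assume "B \<in> S"
    moreover obtain w0 w1 w2 where B: "B = (w0, w1, w2)" by (cases B)
    ultimately have s: "superbase (w0, w1, w2) L" and e: "w0 \<bullet> w0 + w1 \<bullet> w1 + w2 \<bullet> w2 \<le> E"
      by (auto simp: S_def superbase_energy_def)
    have "w0 \<bullet> w0 \<le> E" "w1 \<bullet> w1 \<le> E" "w2 \<bullet> w2 \<le> E"
      using e inner_ge_zero[of w0] inner_ge_zero[of w1] inner_ge_zero[of w2] by linarith+
    then have "norm w0 \<le> sqrt E" "norm w1 \<le> sqrt E" "norm w2 \<le> sqrt E"
      by (simp_all add: norm_eq_sqrt_inner)
    then show "B \<in> A \<times> A \<times> A" using superbase_subset[OF s] by (simp add: A_def B)
  qed
  moreover have "finite A" unfolding A_def L by (rule finite_lattice_ball[OF D])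
  ultimately have "finite S" by (meson finite_SigmaI finite_subset)
  moreover have "(- v1 - v2, v1, v2) \<in> S"
    using D by (simp add: S_def E_def L superbase_iff)
  ultimately obtain B where B: "is_arg_min superbase_energy (\<lambda>B. B \<in> S) B"
    using ex_is_arg_min_if_finite by blast
  show ?thesis
  proof
    show "superbase B L" using B by (simp add: is_arg_min_def S_def)
    show "superbase_energy B \<le> superbase_energy B'" if "superbase B' L" for B'
    proof (cases "B' \<in> S")
      case True
      then show ?thesis using B unfolding is_arg_min_linorder by blast
    next
      case False
      then have "E < superbase_energy B'" using that by (simp add: S_def)
      then show ?thesis using B by (simp add: is_arg_min_def S_def)
    qed
  qed
qed

theorem obtuse_superbase_exists:
  assumes "planar_lattice L"
  obtains v0 v1 v2 where "obtuse_superbase (v0, v1, v2) L"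
proof -
  obtain B where "superbase B L" and "\<And>B'. superbase B' L \<Longrightarrow> superbase_energy B \<le> superbase_energy B'"
    using ex_min_energy_superbase[OF assms] by blast
  moreover obtain v0 v1 v2 where "B = (v0, v1, v2)" by (cases B)
  ultimately have s: "superbase (v0, v1, v2) L"
    and min: "\<And>B'. superbase B' L \<Longrightarrow> superbase_energy (v0, v1, v2) \<le> superbase_energy B'" by auto
  have ob: "conorm u1 u2 \<ge> 0"
    if "superbase (u0, u1, u2) L" "superbase_energy (u0, u1, u2) = superbase_energy (v0, v1, v2)" for u0 u1 u2
  proof -
    have u0: "u0 = - u1 - u2" using that(1) by (simp add: superbase_iff)
    have "superbase_energy (u0, u1, u2) \<le> superbase_energy (u1 - u2, - u1, u2)"
      using min superbase_reduce that by simp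
    then show ?thesis
      by (simp add: superbase_energy_def u0 conorm_def inner_diff_left inner_diff_right inner_commute)
  qed
  have "obtuse (v0, v1, v2)"
    \<comment> \<open>The energy is symmetric in the three vectors, so \<open>ob\<close> applies to
      each reordering; the three used here put each pair of vectors in the last two places
      once.\<close>
    using ob[OF s] ob[OF superbase_swap(1)[OF s]] ob[OF superbase_swap(2)[OF superbase_swap(1)[OF superbase_swap(2)[OF s]]]]
    by (simp add: superbase_energy_def conorm_def inner_commute)
  then show ?thesis using that s by (simp add: obtuse_superbase_def)
qed

section \<open>Independence of the root invariant\<close>

text \<open>The point is that with nonnegative conorms no term is negative. Of \<open>m\<close>,
  \<open>n\<close> and \<open>m - n\<close>, exactly two are odd unless \<open>m\<close> and
  \<open>n\<close> are both even, and the square of an odd integer is at least 1. So the class of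
  \<open>x\<close> modulo 2L bounds its length from below by a sum of two conorms.\<close>

lemma selling_formula:
  fixes m n :: real
  assumes "v0 = - v1 - v2" and "x = m *\<^sub>R v1 + n *\<^sub>R v2"
  shows "x \<bullet> x = m\<^sup>2 * conorm v0 v1 + n\<^sup>2 * conorm v0 v2 + (m - n)\<^sup>2 * conorm v1 v2"
  by (simp add: assms conorm_def inner_add_left inner_add_right inner_diff_left inner_commute
      power2_eq_square algebra_simps)

lemma odd_square_ge_1:
  assumes "odd k"
  shows "1 \<le> (of_int k :: real)\<^sup>2"
proof -
  have "k \<noteq> 0" using assms by auto
  then have "1 \<le> k\<^sup>2" by (simp add: int_one_le_iff_zero_less)
  then show ?thesis by (metis of_int_1_le_iff of_int_power)
qed

text \<open>A vector of an obtuse superbase is shortest in its class modulo \<open>2\<Lambda>\<close>.\<close>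
lemma obtuse_superbase_shortest:
  assumes ob: "obtuse_superbase (v0, v1, v2) L" and x: "x = of_int m *\<^sub>R v1 + of_int n *\<^sub>R v2"
  shows "odd m \<Longrightarrow> odd n \<Longrightarrow> norm v0 \<le> norm x"
    and "odd m \<Longrightarrow> even n \<Longrightarrow> norm v1 \<le> norm x"
    and "even m \<Longrightarrow> odd n \<Longrightarrow> norm v2 \<le> norm x"
proof -
  have v0: "v0 = - v1 - v2" and c: "conorm v0 v1 \<ge> 0" "conorm v0 v2 \<ge> 0" "conorm v1 v2 \<ge> 0"
    using ob by (auto simp: obtuse_superbase_def superbase_iff)
  note s = selling_formula[OF v0 x]
  \<comment> \<open>Each squared length is the sum of the two conorms involving that vector:
    precisely those with odd coefficients in its class.\<close>
  have v: "v0 \<bullet> v0 = conorm v0 v1 + conorm v0 v2" "v1 \<bullet> v1 = conorm v0 v1 + conorm v1 v2"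
    "v2 \<bullet> v2 = conorm v0 v2 + conorm v1 v2"
    by (simp_all add: v0 conorm_def inner_diff_left inner_diff_right inner_commute)
  have o: "p \<le> (of_int k)\<^sup>2 * p" if "odd k" "0 \<le> p" for k :: int and p :: real
    using mult_right_mono[OF odd_square_ge_1[OF that(1)] that(2)] by simp
  have z: "0 \<le> (of_int k)\<^sup>2 * p" if "0 \<le> p" for k :: int and p :: real
    using that by simp
  show "norm v0 \<le> norm x" if "odd m" "odd n"
    using o[OF that(1) c(1)] o[OF that(2) c(2)] z[OF c(3), of "m - n"] by (simp add: norm_le s v)
  show "norm v1 \<le> norm x" if "odd m" "even n"
    using o[OF that(1) c(1)] o[OF _ c(3), of "m - n"] z[OF c(2), of n] that by (simp add: norm_le s v)
  show "norm v2 \<le> norm x" if "even m" "odd n"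
    using o[OF that(2) c(2)] o[OF _ c(3), of "m - n"] z[OF c(1), of m] that by (simp add: norm_le s v)
qed

text \<open>The coordinate matrices between two bases of one lattice are integral in both
  directions, so their determinants multiply to 1. Oddness is what makes the matrix invertible
  modulo 2.\<close>

lemma superbase_coordinates_det_odd:
  fixes a b c d :: int
  assumes "superbase (v0, v1, v2) L" "superbase (w0, w1, w2) L"
    and w: "w1 = of_int a *\<^sub>R v1 + of_int b *\<^sub>R v2" "w2 = of_int c *\<^sub>R v1 + of_int d *\<^sub>R v2"
  shows "odd (a * d - b * c)"
proof -
  have D: "det_columns v1 v2 \<noteq> 0" using assms(1) by (simp add: superbase_iff)
  have "v1 \<in> generated_lattice w1 w2" "v2 \<in> generated_lattice w1 w2"
    using superbase_subset[OF assms(1)] assms(2) by (auto simp: superbase_iff)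
  then obtain a' b' c' d' :: int where v: "v1 = of_int a' *\<^sub>R w1 + of_int b' *\<^sub>R w2"
    "v2 = of_int c' *\<^sub>R w1 + of_int d' *\<^sub>R w2"
    by (metis generated_latticeE)
  have bilinear: "det_columns (of_int p *\<^sub>R x + of_int q *\<^sub>R y) (of_int r *\<^sub>R x + of_int s *\<^sub>R y)
      = of_int (p * s - q * r) * det_columns x y" for p q r s :: int and x y
    by (simp add: det_columns_eqs det_columns_commute[of y x] algebra_simps)
  have "det_columns w1 w2 = of_int (a * d - b * c) * det_columns v1 v2"
    unfolding w by (rule bilinear)
  moreover have "det_columns v1 v2 = of_int (a' * d' - b' * c') * det_columns w1 w2"
    using bilinear[of a' w1 b' w2 c' d'] by (simp only: v[symmetric])
  ultimately have "of_int ((a' * d' - b' * c') * (a * d - b * c)) * det_columns v1 v2 = det_columns v1 v2"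
    by (metis mult.assoc of_int_mult)
  then have "(of_int ((a' * d' - b' * c') * (a * d - b * c)) :: real) = 1" using D by simp
  then have "(a' * d' - b' * c') * (a * d - b * c) = 1" by (simp only: of_int_eq_1_iff)
  then show ?thesis by (metis even_mult_iff odd_one)
qed

text \<open>A matrix invertible modulo 2 permutes the three nonzero classes of L/2L. Thus
  \<open>w0\<close>, \<open>w1\<close>, \<open>w2\<close> lie in the classes of \<open>v0\<close>,
  \<open>v1\<close>, \<open>v2\<close> in some order, and each is compared with the shortest vector
  of its class. The six cases below are the six invertible 2 by 2 matrices over the field with two
  elements.\<close>

lemma obtuse_superbase_norm_le:
  assumes v: "obtuse_superbase (v0, v1, v2) L" and w: "superbase (w0, w1, w2) L"
  obtains u0 u1 u2 where "mset [u0, u1, u2] = mset [v0, v1, v2]"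
    "norm u0 \<le> norm w0" "norm u1 \<le> norm w1" "norm u2 \<le> norm w2"
proof -
  have v': "superbase (v0, v1, v2) L" using v by (simp add: obtuse_superbase_def)
  then have L: "L = generated_lattice v1 v2" by (simp add: superbase_iff)
  obtain a b c d :: int where w12: "w1 = of_int a *\<^sub>R v1 + of_int b *\<^sub>R v2"
    "w2 = of_int c *\<^sub>R v1 + of_int d *\<^sub>R v2"
    using superbase_subset[OF w] unfolding L by (metis generated_latticeE insert_subset)
  have w0: "w0 = of_int (- a - c) *\<^sub>R v1 + of_int (- b - d) *\<^sub>R v2"
    using w by (simp add: superbase_iff w12 algebra_simps)
  have odd: "odd (a * d - b * c)" by (rule superbase_coordinates_det_odd[OF v' w w12])
  note n = obtuse_superbase_shortest[OF v w0] obtuse_superbase_shortest[OF v w12(1)]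
    obtuse_superbase_shortest[OF v w12(2)]
  consider "odd a" "odd b" "odd c" "even d" | "odd a" "odd b" "even c" "odd d"
    | "odd a" "even b" "odd c" "odd d" | "odd a" "even b" "even c" "odd d"
    | "even a" "odd b" "odd c" "odd d" | "even a" "odd b" "odd c" "even d"
    using odd by auto
  then show ?thesis
  proof cases
    case 1 then show ?thesis using n by (intro that[of v2 v0 v1]) auto
  next
    case 2 then show ?thesis using n by (intro that[of v1 v0 v2]) auto
  next
    case 3 then show ?thesis using n by (intro that[of v2 v1 v0]) auto
  next
    case 4 then show ?thesis using n by (intro that[of v0 v1 v2]) auto
  next
    case 5 then show ?thesis using n by (intro that[of v1 v2 v0]) auto
  next
    case 6 then show ?thesis using n by (intro that[of v0 v2 v1]) auto
  qed
qed

lemma sum_norm_permute: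
  assumes "mset [u0, u1, u2] = mset [v0, v1, v2]"
  shows "norm u0 + norm u1 + norm u2 = norm v0 + norm v1 + norm v2"
  using assms by (rule mset_triple_cases) simp_all

text \<open>Polarisation, using that the three vectors sum to 0. It passes from equal lengths to
  equal conorms.\<close>

lemma conorm_eq_norms:
  assumes "superbase (v0, v1, v2) L"
  shows "conorm v1 v2 = ((norm v1)\<^sup>2 + (norm v2)\<^sup>2 - (norm v0)\<^sup>2) / 2"
    and "conorm v0 v2 = ((norm v0)\<^sup>2 + (norm v2)\<^sup>2 - (norm v1)\<^sup>2) / 2"
    and "conorm v0 v1 = ((norm v0)\<^sup>2 + (norm v1)\<^sup>2 - (norm v2)\<^sup>2) / 2"
  using assms
  by (simp_all add: superbase_iff conorm_def power2_norm_eq_inner inner_diff_left inner_diff_right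
      inner_commute)

lemma superbase_RI_unique:
  assumes v: "obtuse_superbase (v0, v1, v2) L" and w: "obtuse_superbase (w0, w1, w2) L"
  shows "superbase_RI (v0, v1, v2) = superbase_RI (w0, w1, w2)"
proof -
  have v': "superbase (v0, v1, v2) L" and w': "superbase (w0, w1, w2) L"
    using v w by (simp_all add: obtuse_superbase_def)
  obtain u0 u1 u2 where u: "mset [u0, u1, u2] = mset [v0, v1, v2]"
    and le: "norm u0 \<le> norm w0" "norm u1 \<le> norm w1" "norm u2 \<le> norm w2"
    using obtuse_superbase_norm_le[OF v w'] by blast
  obtain t0 t1 t2 where t: "mset [t0, t1, t2] = mset [w0, w1, w2]"
    and le': "norm t0 \<le> norm v0" "norm t1 \<le> norm v1" "norm t2 \<le> norm v2"
    using obtuse_superbase_norm_le[OF w v'] by blast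
  \<comment> \<open>The two families of inequalities bound each total length by the other. The
    totals agree, so every single inequality is an equality.\<close>
  have "norm w0 = norm u0" "norm w1 = norm u1" "norm w2 = norm u2"
    using le le' sum_norm_permute[OF u] sum_norm_permute[OF t] by linarith+
  then have "superbase_RI (u0, u1, u2) = superbase_RI (w0, w1, w2)"
    using conorm_eq_norms[OF superbase_permute[OF v' u]] conorm_eq_norms[OF w']
    by (simp add: root_product_def)
  then show ?thesis using superbase_RI_permute[OF u] by simp
qed

text \<open>This removes the choice operator: from here on any convenient obtuse superbase computes
  the invariant.\<close>

lemma RI_eq:
  assumes "obtuse_superbase (v0, v1, v2) L"
  shows "RI L = superbase_RI (v0, v1, v2)"
proof -
  have "obtuse_superbase (SOME B. obtuse_superbase B L) L" using assms by (rule someI)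
  then show ?thesis
    unfolding RI_def by (metis assms superbase_RI_unique surj_pair)
qed

section \<open>Realising equal root invariants by isometries\<close>

lemma obtuse_superbase_image:
  assumes g: "orthogonal_transformation g" and v: "obtuse_superbase (v0, v1, v2) L"
  shows "obtuse_superbase (g v0, g v1, g v2) (g ` L)"
    and "superbase_RI (g v0, g v1, g v2) = superbase_RI (v0, v1, v2)"
proof -
  have lin: "linear g" using g by (rule orthogonal_transformation_linear)
  have c: "conorm (g x) (g y) = conorm x y" for x y
    using g by (simp add: conorm_def orthogonal_transformation_def)
  have "superbase (v0, v1, v2) L" using v by (simp add: obtuse_superbase_def)
  then have "superbase (g v0, g v1, g v2) (g ` L)"
    using det_orthogonal_transformation[OF g]
    by (auto simp: superbase_iff det_columns_linear_image[OF lin] generated_lattice_linear_image[OF lin]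
        linear_diff[OF lin] linear_neg[OF lin])
  then show "obtuse_superbase (g v0, g v1, g v2) (g ` L)"
    using v by (simp add: obtuse_superbase_def c)
  show "superbase_RI (g v0, g v1, g v2) = superbase_RI (v0, v1, v2)"
    by (simp add: root_product_def c)
qed

lemma isometry_of_equal_conorms:
  assumes v: "superbase (v0, v1, v2) L" and u: "superbase (u0, u1, u2) L'"
    and c: "conorm u0 u1 = conorm v0 v1" "conorm u0 u2 = conorm v0 v2" "conorm u1 u2 = conorm v1 v2"
  obtains g where "orthogonal_transformation g" "g ` L = L'" "g v0 = u0" "g v1 = u1" "g v2 = u2"
proof -
  have v': "det_columns v1 v2 \<noteq> 0" "L = generated_lattice v1 v2" "v0 = - v1 - v2"
    and u': "L' = generated_lattice u1 u2" "u0 = - u1 - u2"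
    using v u by (simp_all add: superbase_iff)
  have "u1 \<bullet> u1 = v1 \<bullet> v1" "u2 \<bullet> u2 = v2 \<bullet> v2" "u1 \<bullet> u2 = v1 \<bullet> v2"
    using c by (simp_all add: v' u' conorm_def inner_diff_left inner_diff_right inner_commute)
  then obtain g where g: "orthogonal_transformation g" "g v1 = u1" "g v2 = u2"
    using orthogonal_transformation_of_basis[OF v'(1)] by metis
  have lin: "linear g" using g(1) by (rule orthogonal_transformation_linear)
  have "g v0 = u0" by (simp add: v' u' linear_diff[OF lin] linear_neg[OF lin] g)
  moreover have "g ` L = L'" by (simp add: v' u' generated_lattice_linear_image[OF lin] g)
  ultimately show ?thesis using that g by blast
qed

text \<open>The sorted list forgets which pair of vectors a root product belongs to. Nothing is
  lost, because a pair among three vectors is determined by the vector left out, so each permutation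
  of the conorms comes from a permutation of the vectors.\<close>

lemma isometry_of_equal_superbase_RI:
  assumes v: "superbase (v0, v1, v2) L" and w: "superbase (w0, w1, w2) L'"
    and RI: "superbase_RI (v0, v1, v2) = superbase_RI (w0, w1, w2)"
  obtains g where "orthogonal_transformation g" "g ` L = L'"
    "mset [g v0, g v1, g v2] = mset [w0, w1, w2]"
proof -
  have cc: "conorm x y = conorm y x" for x y by (simp add: conorm_def inner_commute)
  let ?isometry = "\<exists>g. orthogonal_transformation g \<and> g ` L = L'
    \<and> mset [g v0, g v1, g v2] = mset [w0, w1, w2]"
  have goal: ?isometry
    if u: "mset [u0, u1, u2] = mset [w0, w1, w2]"
      and c: "conorm u0 u1 = conorm v0 v1" "conorm u0 u2 = conorm v0 v2" "conorm u1 u2 = conorm v1 v2"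
    for u0 u1 u2
    using isometry_of_equal_conorms[OF v superbase_permute[OF w u] c] u by metis
  have "mset [root_product v0 v1, root_product v0 v2, root_product v1 v2]
      = mset [root_product w0 w1, root_product w0 w2, root_product w1 w2]"
    using RI unfolding superbase_RI.simps sort_eq_iff_mset_eq .
  then have ?isometry
    unfolding root_product_def
  \<comment> \<open>\<open>sqrt\<close> is extended to negative reals as an odd function and is
    injective on all reals, so equal root products give equal conorms.\<close>
  proof (rule mset_triple_cases, unfold real_sqrt_eq_iff)
    assume "conorm v0 v1 = conorm w0 w1" "conorm v0 v2 = conorm w0 w2" "conorm v1 v2 = conorm w1 w2"
    then show ?isometry by (intro goal[of w0 w1 w2]) (simp_all add: cc)
  next
    assume "conorm v0 v1 = conorm w0 w1" "conorm v0 v2 = conorm w1 w2" "conorm v1 v2 = conorm w0 w2"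
    then show ?isometry by (intro goal[of w1 w0 w2]) (simp_all add: cc)
  next
    assume "conorm v0 v1 = conorm w0 w2" "conorm v0 v2 = conorm w0 w1" "conorm v1 v2 = conorm w1 w2"
    then show ?isometry by (intro goal[of w0 w2 w1]) (simp_all add: cc)
  next
    assume "conorm v0 v1 = conorm w0 w2" "conorm v0 v2 = conorm w1 w2" "conorm v1 v2 = conorm w0 w1"
    then show ?isometry by (intro goal[of w2 w0 w1]) (simp_all add: cc)
  next
    assume "conorm v0 v1 = conorm w1 w2" "conorm v0 v2 = conorm w0 w1" "conorm v1 v2 = conorm w0 w2"
    then show ?isometry by (intro goal[of w1 w2 w0]) (simp_all add: cc)
  next
    assume "conorm v0 v1 = conorm w1 w2" "conorm v0 v2 = conorm w0 w2" "conorm v1 v2 = conorm w0 w1"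
    then show ?isometry by (intro goal[of w2 w1 w0]) (simp_all add: cc)
  qed
  then show ?thesis using that by blast
qed

section \<open>The sign\<close>

lemma superbase_planar_lattice: "superbase (v0, v1, v2) L \<Longrightarrow> planar_lattice L"
  by (auto simp: planar_lattice_def superbase.simps)

text \<open>If two vectors of a superbase have equal length, swapping them is a reflection of the lattice.\<close>
lemma norm_neq_if_not_mirror_symmetric:
  assumes s: "superbase (v0, v1, v2) L" and "\<not> mirror_symmetric L"
  shows "norm v1 \<noteq> norm v2"
proof
  assume n: "norm v1 = norm v2"
  have D: "det_columns v1 v2 \<noteq> 0" and L: "L = generated_lattice v1 v2" "L = generated_lattice v2 v1"
    using s superbase_swap(2)[OF s] by (simp_all add: superbase_iff)
  obtain g where g: "orthogonal_transformation g" "g v1 = v2" "g v2 = v1"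
    using orthogonal_transformation_of_basis[OF D, of v2 v1] n
    by (metis inner_commute power2_norm_eq_inner)
  have lin: "linear g" using g(1) by (rule orthogonal_transformation_linear)
  \<comment> \<open>Exchanging \<open>v1\<close> and \<open>v2\<close> negates their nonzero
    determinant.\<close>
  have "det (matrix g) \<noteq> 1"
    using det_columns_linear_image[OF lin, of v1 v2] D by (auto simp: g det_columns_commute[of v2 v1])
  then have "det (matrix g) = -1" using det_orthogonal_transformation[OF g(1)] by blast
  moreover have "g ` L = L"
    using generated_lattice_linear_image[OF lin, of v1 v2] g L by metis
  ultimately show False
    using assms(2) g(1) mirror_symmetric_iff[OF superbase_planar_lattice[OF s]] by blast
qed

text \<open>Without mirror symmetry the three lengths are distinct, and \<open>g\<close> preserves
  lengths, so ordering by length commutes with \<open>g\<close>. The determinant of the two shortest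
  vectors is then multiplied by that of \<open>g\<close>. With mirror symmetry both signs are
  0.\<close>

lemma superbase_sign_image:
  assumes v: "superbase (v0, v1, v2) L" and w: "superbase (w0, w1, w2) (g ` L)"
    and g: "orthogonal_transformation g" and gv: "mset [g v0, g v1, g v2] = mset [w0, w1, w2]"
  shows "superbase_sign (w0, w1, w2) = det (matrix g) * superbase_sign (v0, v1, v2)"
proof -
  have L: "L = generated_lattice v1 v2" "g ` L = generated_lattice w1 w2"
    using v w by (simp_all add: superbase_iff)
  note mirror = mirror_symmetric_orthogonal_image[OF g, of L]
  show ?thesis
  proof (cases "mirror_symmetric L")
    case True
    then show ?thesis using mirror by (simp add: L(1)[symmetric] L(2)[symmetric])
  next
    case False
    define vs where "vs = sort_key norm [v0, v1, v2]"
    have lin: "linear g" using g by (rule orthogonal_transformation_linear)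
    have ng: "norm (g x) = norm x" for x using g by (rule orthogonal_transformation_norm)
    have ne: "norm v1 \<noteq> norm v2" "norm v0 \<noteq> norm v2" "norm v0 \<noteq> norm v1"
      using norm_neq_if_not_mirror_symmetric[OF v False]
        norm_neq_if_not_mirror_symmetric[OF superbase_swap(1)[OF v] False]
        norm_neq_if_not_mirror_symmetric[OF superbase_swap(1)[OF superbase_swap(2)[OF v]] False]
      by simp_all
    have ws: "mset [w0, w1, w2] = mset (map g vs)"
      by (simp only: gv[symmetric]) (simp add: vs_def del: sort_key_simps)
    have sorted: "sorted (map norm (map g vs))"
      by (simp add: ng o_def vs_def del: sort_key_simps)
    \<comment> \<open>With ties, \<open>sort_key\<close> would depend on the order of the input;
      distinct norms make its result depend on the multiset alone.\<close>
    have inj: "inj_on norm (set [w0, w1, w2])"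
      unfolding mset_eq_setD[OF gv, symmetric] using ne by (auto simp: inj_on_def ng)
    have "sort_key norm [w0, w1, w2] = map g vs"
      using ws inj sorted by (rule sort_key_inj_key_eq)
    moreover have "length vs = 3" by (simp add: vs_def del: sort_key_simps)
    ultimately have "det_columns (sort_key norm [w0, w1, w2] ! 0) (sort_key norm [w0, w1, w2] ! 1)
        = det (matrix g) * det_columns (vs ! 0) (vs ! 1)"
      by (simp add: det_columns_linear_image[OF lin] del: sort_key_simps)
    moreover have "sgn (det (matrix g)) = det (matrix g)"
      using det_orthogonal_transformation[OF g] by auto
    ultimately show ?thesis
      using False mirror
      by (simp add: L(1)[symmetric] L(2)[symmetric] Let_def vs_def[symmetric] sgn_mult del: sort_key_simps)
  qed
qed

lemma superbase_sign_eq_0_iff: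
  assumes v: "superbase (v0, v1, v2) L"
  shows "superbase_sign (v0, v1, v2) = 0 \<longleftrightarrow> mirror_symmetric L"
proof -
  have D: "det_columns v1 v2 \<noteq> 0" and L: "L = generated_lattice v1 v2" and v0: "v0 = - v1 - v2"
    using v by (simp_all add: superbase_iff)
  \<comment> \<open>Any two vectors of a superbase have determinant plus or minus that of
    \<open>v1\<close> and \<open>v2\<close>, so the sign is nonzero whichever two are the
    shortest.\<close>
  have "det_columns v0 v1 = det_columns v1 v2" "det_columns v0 v2 = - det_columns v1 v2"
    "det_columns v1 v0 = - det_columns v1 v2" "det_columns v2 v0 = det_columns v1 v2"
    "det_columns v2 v1 = - det_columns v1 v2"
    by (simp_all add: v0 det_columns_eqs det_columns_commute[of v2 v1])
  then show ?thesis using D by (simp add: L Let_def sgn_zero_iff)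
qed

text \<open>Two obtuse superbases of \<open>L\<close> have equal root invariants, so an orthogonal
  map preserving \<open>L\<close> matches them. If its determinant is -1, it is itself a mirror
  symmetry of \<open>L\<close>.\<close>

lemma superbase_sign_unique:
  assumes v: "obtuse_superbase (v0, v1, v2) L" and w: "obtuse_superbase (w0, w1, w2) L"
  shows "superbase_sign (v0, v1, v2) = superbase_sign (w0, w1, w2)"
proof -
  have v': "superbase (v0, v1, v2) L" and w': "superbase (w0, w1, w2) L"
    using v w by (simp_all add: obtuse_superbase_def)
  obtain g where g: "orthogonal_transformation g" "g ` L = L"
    "mset [g v0, g v1, g v2] = mset [w0, w1, w2]"
    using isometry_of_equal_superbase_RI[OF v' w' superbase_RI_unique[OF v w]] by metis
  have sign: "superbase_sign (w0, w1, w2) = det (matrix g) * superbase_sign (v0, v1, v2)"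
    using superbase_sign_image[OF v' _ g(1) g(3)] w' g(2) by simp
  show ?thesis
  proof (cases "det (matrix g) = 1")
    case False
    then have "mirror_symmetric L"
      using det_orthogonal_transformation[OF g(1)] g mirror_symmetric_iff[OF superbase_planar_lattice[OF v']]
      by blast
    then show ?thesis using superbase_sign_eq_0_iff[OF v'] superbase_sign_eq_0_iff[OF w'] by simp
  qed (simp only: sign mult_1)
qed

lemma lattice_sign_eq:
  assumes "obtuse_superbase (v0, v1, v2) L"
  shows "lattice_sign L = superbase_sign (v0, v1, v2)"
proof -
  have "obtuse_superbase (SOME B. obtuse_superbase B L) L" using assms by (rule someI)
  then show ?thesis
    unfolding lattice_sign_def by (metis assms superbase_sign_unique surj_pair)
qed

section \<open>The invariants under orthogonal maps, and the classification\<close>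

lemma RI_orthogonal_image:
  assumes "planar_lattice L" "orthogonal_transformation g"
  shows "RI (g ` L) = RI L"
  using obtuse_superbase_exists[OF assms(1)] obtuse_superbase_image[OF assms(2)] RI_eq by metis

lemma lattice_sign_orthogonal_image:
  assumes L: "planar_lattice L" and g: "orthogonal_transformation g"
  shows "lattice_sign (g ` L) = det (matrix g) * lattice_sign L"
proof -
  obtain v0 v1 v2 where v: "obtuse_superbase (v0, v1, v2) L"
    using obtuse_superbase_exists[OF L] by blast
  note gv = obtuse_superbase_image(1)[OF g v]
  show ?thesis
    using superbase_sign_image[of v0 v1 v2 L "g v0" "g v1" "g v2" g] v gv g
    by (simp add: lattice_sign_eq[OF v] lattice_sign_eq[OF gv] obtuse_superbase_def del: superbase_sign.simps)
qed

lemma lattice_sign_eq_0_iff: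
  assumes "planar_lattice L"
  shows "lattice_sign L = 0 \<longleftrightarrow> mirror_symmetric L"
proof -
  obtain v0 v1 v2 where v: "obtuse_superbase (v0, v1, v2) L"
    using obtuse_superbase_exists[OF assms] by blast
  then have "superbase (v0, v1, v2) L" by (simp add: obtuse_superbase_def)
  then show ?thesis by (simp only: lattice_sign_eq[OF v] superbase_sign_eq_0_iff)
qed

lemma orthogonal_of_RI_eq:
  assumes "planar_lattice L" "planar_lattice L'" "RI L = RI L'"
  obtains g where "orthogonal_transformation g" "g ` L = L'"
proof -
  obtain v0 v1 v2 w0 w1 w2 where v: "obtuse_superbase (v0, v1, v2) L"
    and w: "obtuse_superbase (w0, w1, w2) L'"
    using obtuse_superbase_exists[OF assms(1)] obtuse_superbase_exists[OF assms(2)] by metis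
  have "superbase (v0, v1, v2) L" "superbase (w0, w1, w2) L'"
    using v w by (simp_all add: obtuse_superbase_def)
  then show ?thesis
    using isometry_of_equal_superbase_RI that assms(3) RI_eq[OF v] RI_eq[OF w] by metis
qed

theorem theorem4p2:
  fixes \<Lambda> \<Lambda>' :: "(real^2) set"
  assumes "planar_lattice \<Lambda>" and "planar_lattice \<Lambda>'"
  shows "(lattices_isometric \<Lambda> \<Lambda>' \<longleftrightarrow> RI \<Lambda> = RI \<Lambda>') \<and>
         (lattices_rigidly_related \<Lambda> \<Lambda>' \<longleftrightarrow> oriented_RI \<Lambda> = oriented_RI \<Lambda>')"
proof
  show "lattices_isometric \<Lambda> \<Lambda>' \<longleftrightarrow> RI \<Lambda> = RI \<Lambda>'"
    unfolding lattices_isometric_iff[OF assms]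
    using RI_orthogonal_image[OF assms(1)] orthogonal_of_RI_eq[OF assms] by metis
  show "lattices_rigidly_related \<Lambda> \<Lambda>' \<longleftrightarrow> oriented_RI \<Lambda> = oriented_RI \<Lambda>'"
  proof
    assume "lattices_rigidly_related \<Lambda> \<Lambda>'"
    then show "oriented_RI \<Lambda> = oriented_RI \<Lambda>'"
      unfolding lattices_rigidly_related_iff[OF assms]
      using RI_orthogonal_image[OF assms(1)] lattice_sign_orthogonal_image[OF assms(1)]
      by (auto simp: oriented_RI_def)
  next
    assume "oriented_RI \<Lambda> = oriented_RI \<Lambda>'"
    then have RI: "RI \<Lambda> = RI \<Lambda>'" and sign: "lattice_sign \<Lambda> = lattice_sign \<Lambda>'"
      by (simp_all add: oriented_RI_def)
    obtain g where g: "orthogonal_transformation g" "g ` \<Lambda> = \<Lambda>'"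
      using orthogonal_of_RI_eq[OF assms RI] by blast
    show "lattices_rigidly_related \<Lambda> \<Lambda>'"
    proof (cases "det (matrix g) = 1")
      case True
      then show ?thesis unfolding lattices_rigidly_related_iff[OF assms] using g by blast
    next
      case False
      then have d: "det (matrix g) = -1" using det_orthogonal_transformation[OF g(1)] by blast
      \<comment> \<open>\<open>g\<close> negates the sign, yet the two lattices have the same sign,
        so it equals its own negative.\<close>
      then have "lattice_sign \<Lambda> = 0"
        using lattice_sign_orthogonal_image[OF assms(1) g(1)] sign g(2) by simp
      then obtain s where s: "orthogonal_transformation s" "det (matrix s) = -1" "s ` \<Lambda> = \<Lambda>"
        using lattice_sign_eq_0_iff[OF assms(1)] mirror_symmetric_iff[OF assms(1)] by blast
      have "orthogonal_transformation (g \<circ> s)"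
        using g(1) s(1) by (rule orthogonal_transformation_compose)
      moreover have "det (matrix (g \<circ> s)) = 1"
        using g(1) s(1) by (simp add: det_matrix_compose orthogonal_transformation_linear d s(2))
      moreover have "(g \<circ> s) ` \<Lambda> = \<Lambda>'" by (simp only: image_comp[symmetric] s(3) g(2))
      ultimately show ?thesis unfolding lattices_rigidly_related_iff[OF assms] by blast
    qed
  qed
qed

end
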